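(* For any $t,s\in\mathbb R_{\ge0}$ such that $t\le s$ and any lower transition rate operator $\underline Q$, there is a unique lower transition operator $\underline T$ such that $$(\forall\epsilon>0)(\exists\delta>0)(\forall u\in\mathcal U_{[t,s]}:\sigma(u)\le\delta)\quad\|\underline T-\Phi_u\|\le\epsilon .$$
   Context: $\mathcal X$ is a fixed finite non-empty set; $\mathcal L(\mathcal X)$ is the set of all $f:\mathcal X\to\mathbb R$, with $\|f\|=\max_x|f(x)|$; inequalities between functions are pointwise. A non-negatively homogeneous operator $A:\mathcal L(\mathcal X)\to\mathcal L(\mathcal X)$ (i.e. $A(\lambda f)=\lambda Af$ for $\lambda\ge0$) has norm $\|A\|=\sup\{\|Af\|:\|f\|=1\}$. $I$ is the identity. A lower transition rate operator is a map $\underline Q:\mathcal L(\mathcal X)\to\mathcal L(\mathcal X)$ such that for all $f,g\in\mathcal L(\mathcal X)$, $\lambda\ge0$, constant functions $\mu$ and $x,y\in\mathcal X$: $[\underline Q\mu](x)=0$; $[\underline Q\mathbb I_y](x)\ge0$ if $x\ne y$ ($\mathbb I_y$ the indicator of $\{y\}$); $\underline Q(f+g)\ge\underline Qf+\underline Qg$; $\underline Q(\lambda f)=\lambda\underline Qf$. A lower transition operator is a map $\underline T:\mathcal L(\mathcal X)\to\mathcal L(\mathcal X)$ with $[\underline Tf](x)\ge\min f$, $\underline T(f+g)\ge\underline Tf+\underline Tg$ and $\underline T(\lambda f)=\lambda\underline Tf$ for $\lambda\ge0$. $\mathcal U_{[t,s]}$ is the set of finite sequences $u:\ t=t_0<t_1<\dots<t_n=s$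 (if $t=s$, only the one-point sequence). $\Delta_i=t_i-t_{i-1}$, $\sigma(u)=\max_i\Delta_i$ (and $0$ if $n=0$), and $\Phi_u=(I+\Delta_1\underline Q)(I+\Delta_2\underline Q)\cdots(I+\Delta_n\underline Q)$ (composition of operators; $\Phi_u=I$ if $n=0$). *)

theory Defs
  imports "HOL-Analysis.Analysis"
begin

text \<open>The finite non-empty state space is the universe of a type \<open>'x :: finite\<close>, so the space
  of real functions on it is the full function type \<open>'x \<Rightarrow> real\<close>, ordered pointwise.\<close>

definition max_norm :: "('x::finite \<Rightarrow> real) \<Rightarrow> real" where
  "max_norm f = Max (range (\<lambda>x. \<bar>f x\<bar>))"

text \<open>The supremum is taken in the extended reals, so that it is meaningful without first knowing
  that the operator is bounded.  In particular \<open>op_norm A \<le> ereal \<epsilon>\<close> entails boundedness.\<close>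

definition op_norm :: "(('x::finite \<Rightarrow> real) \<Rightarrow> ('x \<Rightarrow> real)) \<Rightarrow> ereal" where
  "op_norm A = (SUP f\<in>{f. max_norm f = 1}. ereal (max_norm (A f)))"

definition op_diff ::
  "(('x \<Rightarrow> real) \<Rightarrow> ('x \<Rightarrow> real)) \<Rightarrow> (('x \<Rightarrow> real) \<Rightarrow> ('x \<Rightarrow> real)) \<Rightarrow> ('x \<Rightarrow> real) \<Rightarrow> ('x \<Rightarrow> real)"
  where "op_diff A B = (\<lambda>f x. A f x - B f x)"

definition lower_transition_rate_operator :: "(('x::finite \<Rightarrow> real) \<Rightarrow> ('x \<Rightarrow> real)) \<Rightarrow> bool" where
  "lower_transition_rate_operator Q \<longleftrightarrow>
     (\<forall>\<mu> x. Q (\<lambda>_. \<mu>) x = 0) \<and>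
     (\<forall>x y. x \<noteq> y \<longrightarrow> Q (indicator {y}) x \<ge> 0) \<and>
     (\<forall>f g x. Q (\<lambda>z. f z + g z) x \<ge> Q f x + Q g x) \<and>
     (\<forall>c\<ge>0. \<forall>f x. Q (\<lambda>z. c * f z) x = c * Q f x)"

definition lower_transition_operator :: "(('x::finite \<Rightarrow> real) \<Rightarrow> ('x \<Rightarrow> real)) \<Rightarrow> bool" where
  "lower_transition_operator T \<longleftrightarrow>
     (\<forall>f x. T f x \<ge> Min (range f)) \<and>
     (\<forall>f g x. T (\<lambda>z. f z + g z) x \<ge> T f x + T g x) \<and>
     (\<forall>c\<ge>0. \<forall>f x. T (\<lambda>z. c * f z) x = c * T f x)"

text \<open>A sequence \<open>t = t\<^sub>0 < \<dots> < t\<^sub>n = s\<close> is the list of its \<open>n + 1\<close> points.  For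
  \<open>t = s\<close> strictness leaves only the list \<open>[t]\<close>.\<close>

definition partitions :: "real \<Rightarrow> real \<Rightarrow> real list set" where
  "partitions t s = {u. u \<noteq> [] \<and> sorted_wrt (<) u \<and> hd u = t \<and> last u = s}"

text \<open>\<open>increment u i\<close> is \<open>t\<^sub>i - t\<^sub>i\<^sub>-\<^sub>1\<close>, for \<open>1 \<le> i \<le> n\<close>, where \<open>length u = n + 1\<close>.\<close>

definition increment :: "real list \<Rightarrow> nat \<Rightarrow> real" where
  "increment u i = u ! i - u ! (i - 1)"

definition mesh :: "real list \<Rightarrow> real" where
  "mesh u = (if length u \<le> 1 then 0 else Max (increment u ` {1..<length u}))"

definition euler_step ::
  "(('x \<Rightarrow> real) \<Rightarrow> ('x \<Rightarrow> real)) \<Rightarrow> real \<Rightarrow> ('x \<Rightarrow> real) \<Rightarrow> ('x \<Rightarrow> real)" where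
  "euler_step Q \<Delta> = (\<lambda>f x. f x + \<Delta> * Q f x)"

text \<open>The factor of the first increment is outermost: it is applied last.\<close>

definition euler_product ::
  "(('x \<Rightarrow> real) \<Rightarrow> ('x \<Rightarrow> real)) \<Rightarrow> real list \<Rightarrow> ('x \<Rightarrow> real) \<Rightarrow> ('x \<Rightarrow> real)" where
  "euler_product Q u = foldr (\<lambda>i A. euler_step Q (increment u i) \<circ> A) [1..<length u] id"

end

theory Submission
  imports Defs
begin

text \<open>For small \<open>\<Delta>\<close> the Euler step \<open>I + \<Delta> Q\<close> is a lower transition operator, hence nonexpansive
  in the maximum norm; this also makes \<open>Q\<close> Lipschitz, with some constant \<open>M\<close>.  Splitting a step
  \<open>a + b\<close> into \<open>a\<close> and \<open>b\<close> changes its value at \<open>f\<close> by at most \<open>M\<^sup>2 a b \<parallel>f\<parallel>\<close>, which is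
  \<open>M\<^sup>2 \<parallel>f\<parallel> / 2\<close> times the loss \<open>(a + b)\<^sup>2 - a\<^sup>2 - b\<^sup>2\<close> in the sum of the squared increments.
  Consequently two partitions of the same interval give products that differ by at most
  \<open>M\<^sup>2 \<parallel>f\<parallel> / 2\<close> times the total of their squared increments, a quantity that vanishes with the
  mesh.  The products are therefore Cauchy and their limit inherits the defining inequalities.\<close>

section \<open>Maximum norm and operator norm\<close>

lemma abs_le_max_norm: "\<bar>f x\<bar> \<le> max_norm (f :: 'x::finite \<Rightarrow> real)"
  unfolding max_norm_def by (rule Max_ge) auto

lemma max_norm_le_iff: "max_norm (f :: 'x::finite \<Rightarrow> real) \<le> c \<longleftrightarrow> (\<forall>x. \<bar>f x\<bar> \<le> c)"
  unfolding max_norm_def by (subst Max_le_iff) auto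

lemma max_norm_nonneg: "0 \<le> max_norm (f :: 'x::finite \<Rightarrow> real)"
  using abs_le_max_norm[of f undefined] by linarith

lemma max_norm_scale: "max_norm (\<lambda>x. c * f x) = \<bar>c\<bar> * max_norm (f :: 'x::finite \<Rightarrow> real)"
proof -
  have "max_norm (\<lambda>x. c * f x) = Max ((\<lambda>r. \<bar>c\<bar> * r) ` range (\<lambda>x. \<bar>f x\<bar>))"
    by (simp add: max_norm_def image_image abs_mult)
  also have "\<dots> = \<bar>c\<bar> * Max (range (\<lambda>x. \<bar>f x\<bar>))"
    by (rule mono_Max_commute[symmetric]) (auto simp: mono_def mult_left_mono)
  finally show ?thesis by (simp add: max_norm_def)
qed

text \<open>The extended-real supremum becomes a family of pointwise real estimates on the unit
  sphere; operator norms enter the argument only in this form.\<close>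

lemma op_norm_diff_le_iff:
  "op_norm (op_diff A B) \<le> ereal c \<longleftrightarrow> (\<forall>f x. max_norm f = 1 \<longrightarrow> \<bar>A f x - B f x\<bar> \<le> c)"
  by (auto simp: op_norm_def op_diff_def SUP_le_iff max_norm_le_iff)

section \<open>Lower transition operators\<close>

lemma lower_transition_operatorD:
  assumes "lower_transition_operator T"
  shows "Min (range f) \<le> T f x" "T f x + T g x \<le> T (\<lambda>z. f z + g z) x"
    "0 \<le> c \<Longrightarrow> T (\<lambda>z. c * f z) x = c * T f x"
  using assms by (auto simp: lower_transition_operator_def)

lemma lower_transition_operator_zero:
  assumes "lower_transition_operator T"
  shows "T (\<lambda>_. 0) = (\<lambda>_. 0)"
  using lower_transition_operatorD(3)[OF assms, of 0 "\<lambda>_. 0"] by auto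

text \<open>Writing \<open>f = g + (f - g)\<close>, superadditivity and the minimum bound keep
  \<open>T f\<close> above \<open>T g\<close> minus the distance of \<open>f\<close> and
  \<open>g\<close>; exchanging the two functions gives the other half.\<close>

lemma lower_transition_operator_nonexpansive:
  assumes T: "lower_transition_operator T"
  shows "\<bar>T f x - T g x\<bar> \<le> max_norm (\<lambda>z. f z - g z)"
proof -
  have *: "T g x - max_norm (\<lambda>z. f z - g z) \<le> T f x" for f g
  proof -
    have "- max_norm (\<lambda>z. f z - g z) \<le> Min (range (\<lambda>z. f z - g z))"
      using abs_le_max_norm[of "\<lambda>z. f z - g z"] by (auto simp: abs_le_iff minus_le_iff)
    also have "\<dots> \<le> T (\<lambda>z. f z - g z) x"
      by (rule lower_transition_operatorD(1)[OF T])
    finally show ?thesis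
      using lower_transition_operatorD(2)[OF T, of g x "\<lambda>z. f z - g z"] by simp
  qed
  have "max_norm (\<lambda>z. g z - f z) = max_norm (\<lambda>z. f z - g z)"
    by (simp add: max_norm_def abs_minus_commute)
  then show ?thesis using *[of g f] *[of f g] by simp
qed

lemma lower_transition_operator_norm_le:
  assumes T: "lower_transition_operator T"
  shows "max_norm (T f) \<le> max_norm f"
  using lower_transition_operator_nonexpansive[OF T, of f _ "\<lambda>_. 0"]
  by (simp add: max_norm_le_iff lower_transition_operator_zero[OF T])

text \<open>Superadditivity makes \<open>T g - T f\<close> dominate \<open>T (g - f)\<close>, which
  is nonnegative by the minimum bound.\<close>

lemma lower_transition_operator_mono:
  assumes T: "lower_transition_operator T" and le: "\<And>z. f z \<le> g z"
  shows "T f x \<le> T g x"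
proof -
  have "0 \<le> Min (range (\<lambda>z. g z - f z))" using le by auto
  then show ?thesis
    using lower_transition_operatorD(1)[OF T, of "\<lambda>z. g z - f z" x]
      lower_transition_operatorD(2)[OF T, of f x "\<lambda>z. g z - f z"] by (simp del: Min_ge_iff)
qed

lemma lower_transition_operator_id: "lower_transition_operator id"
  by (auto simp: lower_transition_operator_def)

lemma lower_transition_operator_comp:
  assumes S: "lower_transition_operator S" and T: "lower_transition_operator T"
  shows "lower_transition_operator (S \<circ> T)"
  unfolding lower_transition_operator_def
proof (intro conjI allI impI)
  fix f g :: "'a \<Rightarrow> real" and x and c :: real
  have "Min (range f) \<le> Min (range (T f))"
    using lower_transition_operatorD(1)[OF T] by auto
  also have "\<dots> \<le> S (T f) x" by (rule lower_transition_operatorD(1)[OF S])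
  finally show "Min (range f) \<le> (S \<circ> T) f x" by simp
  have "S (T f) x + S (T g) x \<le> S (\<lambda>z. T f z + T g z) x"
    by (rule lower_transition_operatorD(2)[OF S])
  also have "\<dots> \<le> S (T (\<lambda>z. f z + g z)) x"
    by (intro lower_transition_operator_mono[OF S] lower_transition_operatorD(2)[OF T])
  finally show "(S \<circ> T) f x + (S \<circ> T) g x \<le> (S \<circ> T) (\<lambda>z. f z + g z) x" by simp
  assume c: "0 \<le> c"
  have "T (\<lambda>z. c * f z) = (\<lambda>z. c * T f z)"
    using lower_transition_operatorD(3)[OF T c] by auto
  then show "(S \<circ> T) (\<lambda>z. c * f z) x = c * (S \<circ> T) f x"
    using lower_transition_operatorD(3)[OF S c] by simp
qed

text \<open>Each defining condition is a weak inequality or an equality between values at fixed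
  arguments, so it survives a pointwise limit.\<close>

lemma lower_transition_operator_limit:
  assumes S: "\<And>n. lower_transition_operator (S n)"
    and lim: "\<And>f x. (\<lambda>n. S n f x) \<longlonglongrightarrow> T f x"
  shows "lower_transition_operator T"
  unfolding lower_transition_operator_def
proof (intro conjI allI impI)
  fix f g :: "'a \<Rightarrow> real" and x and c :: real
  show "Min (range f) \<le> T f x"
    by (rule LIMSEQ_le_const[OF lim]) (use lower_transition_operatorD(1)[OF S] in blast)
  show "T f x + T g x \<le> T (\<lambda>z. f z + g z) x"
    by (rule LIMSEQ_le[OF tendsto_add[OF lim lim] lim])
      (use lower_transition_operatorD(2)[OF S] in blast)
  assume "0 \<le> c"
  then have "(\<lambda>n. c * S n f x) \<longlonglongrightarrow> T (\<lambda>z. c * f z) x"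
    using lim[of "\<lambda>z. c * f z" x] lower_transition_operatorD(3)[OF S] by simp
  then show "T (\<lambda>z. c * f z) x = c * T f x"
    using tendsto_mult_left[OF lim] LIMSEQ_unique by blast
qed

section \<open>Rate operators and Euler steps\<close>

text \<open>The sum dominates the absolute value of every diagonal rate, and the summand 1 makes
  division by the bound possible. Twice this number serves as the Lipschitz constant
  \<open>M\<close> of the opening comment.\<close>

definition rate_bound :: "(('x::finite \<Rightarrow> real) \<Rightarrow> 'x \<Rightarrow> real) \<Rightarrow> real" where
  "rate_bound Q = 1 + (\<Sum>x\<in>UNIV. \<bar>Q (indicator {x}) x\<bar>)"

text \<open>Indexing by step sizes instead of partition points lets a leading step be removed or
  shortened without touching the others.\<close>

definition euler_composition ::
  "(('x \<Rightarrow> real) \<Rightarrow> 'x \<Rightarrow> real) \<Rightarrow> real list \<Rightarrow> ('x \<Rightarrow> real) \<Rightarrow> 'x \<Rightarrow> real" where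
  "euler_composition Q ds = foldr (\<lambda>d A. euler_step Q d \<circ> A) ds id"

lemma euler_composition_simps [simp]:
  "euler_composition Q [] = id"
  "euler_composition Q (d # ds) = euler_step Q d \<circ> euler_composition Q ds"
  by (simp_all add: euler_composition_def)

lemma euler_composition_zero:
  assumes "\<forall>d\<in>set ds. d = 0"
  shows "euler_composition Q ds = id"
  using assms by (induction ds) (auto simp: euler_step_def)

lemma rate_bound_pos: "0 < rate_bound Q"
  unfolding rate_bound_def by (intro add_pos_nonneg sum_nonneg) auto

context
  fixes Q :: "('x::finite \<Rightarrow> real) \<Rightarrow> 'x \<Rightarrow> real"
  assumes Q: "lower_transition_rate_operator Q"
begin

lemma rate_operator_const: "Q (\<lambda>_. c) x = 0"
  and rate_operator_indicator: "x \<noteq> y \<Longrightarrow> 0 \<le> Q (indicator {y}) x"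
  and rate_operator_add: "Q f x + Q g x \<le> Q (\<lambda>z. f z + g z) x"
  and rate_operator_scale: "0 \<le> c \<Longrightarrow> Q (\<lambda>z. c * f z) x = c * Q f x"
  using Q unfolding lower_transition_rate_operator_def by blast+

lemma rate_operator_sum:
  assumes "finite A"
  shows "(\<Sum>y\<in>A. Q (h y) x) \<le> Q (\<lambda>z. \<Sum>y\<in>A. h y z) x"
  using assms
proof (induction A rule: finite_induct)
  case empty
  then show ?case using rate_operator_const[of 0] by simp
next
  case (insert y A)
  then show ?case using rate_operator_add[of "h y" x "\<lambda>z. \<Sum>y\<in>A. h y z"] by simp
qed

text \<open>Expanding \<open>h\<close> in indicators, superadditivity and homogeneity bound
  \<open>Q h x\<close> below by a linear combination of the rates at \<open>x\<close>, whose
  off-diagonal terms are nonnegative.\<close>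

lemma rate_operator_ge_diagonal:
  assumes h: "\<And>z. 0 \<le> h z"
  shows "h x * Q (indicator {x}) x \<le> Q h x"
proof -
  have "h = (\<lambda>z. \<Sum>y\<in>UNIV. h y * indicator {y} z)"
    by (auto simp: indicator_def of_bool_def if_distrib cong: if_cong)
  then have "(\<Sum>y\<in>UNIV. Q (\<lambda>z. h y * indicator {y} z) x) \<le> Q h x"
    using rate_operator_sum[of UNIV "\<lambda>y z. h y * indicator {y} z" x] by simp
  then have "(\<Sum>y\<in>UNIV. h y * Q (indicator {y}) x) \<le> Q h x"
    using rate_operator_scale[OF h] by simp
  moreover have "h x * Q (indicator {x}) x \<le> (\<Sum>y\<in>UNIV. h y * Q (indicator {y}) x)"
    unfolding sum.remove[OF finite UNIV_I[of x]]
    by (auto intro!: sum_nonneg mult_nonneg_nonneg h rate_operator_indicator)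
  ultimately show ?thesis by linarith
qed

text \<open>The smallness of \<open>d\<close> serves the minimum bound: the diagonal estimate is
  applied to the nonnegative function \<open>f - m\<close>, and its factor
  \<open>1 + d * Q (indicator {x}) x\<close> must not be negative. Removing the constant
  \<open>m\<close> again costs nothing, as \<open>Q\<close> vanishes on constants.\<close>

lemma lower_transition_operator_euler_step:
  assumes d: "0 \<le> d" "d * rate_bound Q \<le> 1"
  shows "lower_transition_operator (euler_step Q d)"
  unfolding lower_transition_operator_def
proof (intro conjI allI impI)
  fix f g :: "'x \<Rightarrow> real" and x and c :: real
  define m where "m = Min (range f)"
  have nonneg: "0 \<le> f z - m" for z by (simp add: m_def)
  have "\<bar>Q (indicator {x}) x\<bar> \<le> rate_bound Q"
    using member_le_sum[of x UNIV "\<lambda>x. \<bar>Q (indicator {x}) x\<bar>"] by (simp add: rate_bound_def)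
  then have "d * \<bar>Q (indicator {x}) x\<bar> \<le> 1"
    using d mult_left_mono by fastforce
  moreover have "- (d * \<bar>Q (indicator {x}) x\<bar>) \<le> d * Q (indicator {x}) x"
    using mult_left_mono[OF neg_le_iff_le[THEN iffD2, OF abs_ge_minus_self] d(1)] by simp
  ultimately have "0 \<le> (f x - m) * (1 + d * Q (indicator {x}) x)"
    using nonneg by simp
  also have "\<dots> \<le> (f x - m) + d * Q f x"
  proof -
    have "Q (\<lambda>z. f z - m) x \<le> Q f x"
      using rate_operator_add[of "\<lambda>z. f z - m" x "\<lambda>_. m"] by (simp add: rate_operator_const)
    then have "(f x - m) * Q (indicator {x}) x \<le> Q f x"
      using rate_operator_ge_diagonal[of "\<lambda>z. f z - m" x] nonneg by simp
    then show ?thesis using mult_left_mono[OF _ d(1)] by (fastforce simp: algebra_simps)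
  qed
  finally show "Min (range f) \<le> euler_step Q d f x"
    by (simp add: euler_step_def m_def)
  show "euler_step Q d f x + euler_step Q d g x \<le> euler_step Q d (\<lambda>z. f z + g z) x"
    using mult_left_mono[OF rate_operator_add d(1), of f x g]
    by (simp add: euler_step_def algebra_simps)
  assume "0 \<le> c"
  then show "euler_step Q d (\<lambda>z. c * f z) x = c * euler_step Q d f x"
    by (simp add: euler_step_def rate_operator_scale algebra_simps)
qed

lemma lower_transition_operator_euler_composition:
  assumes "\<And>d. d \<in> set ds \<Longrightarrow> 0 \<le> d \<and> d * rate_bound Q \<le> 1"
  shows "lower_transition_operator (euler_composition Q ds)"
  using assms
  by (induction ds)
    (auto intro!: lower_transition_operator_comp lower_transition_operator_euler_step
      lower_transition_operator_id)

text \<open>With step \<open>1 / K\<close>, the operator \<open>Q / K\<close> is the Euler step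
  minus the identity. Both are nonexpansive, whence the factor 2.\<close>

lemma rate_operator_lipschitz:
  "\<bar>Q f x - Q g x\<bar> \<le> 2 * rate_bound Q * max_norm (\<lambda>z. f z - g z)"
proof -
  define K where "K = rate_bound Q"
  have K: "0 < K" by (simp add: K_def rate_bound_pos)
  have "lower_transition_operator (euler_step Q (1 / K))"
    using K by (intro lower_transition_operator_euler_step) (auto simp: K_def)
  from lower_transition_operator_nonexpansive[OF this, of f x g]
  have "\<bar>(f x - g x) + (Q f x - Q g x) / K\<bar> \<le> max_norm (\<lambda>z. f z - g z)"
    by (simp add: euler_step_def diff_divide_distrib algebra_simps)
  then have "\<bar>(Q f x - Q g x) / K\<bar> \<le> 2 * max_norm (\<lambda>z. f z - g z)"
    using abs_le_max_norm[of "\<lambda>z. f z - g z" x] by linarith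
  then show ?thesis
    using K by (simp add: abs_divide field_simps K_def[symmetric])
qed

lemma max_norm_rate_operator_le: "max_norm (Q f) \<le> 2 * rate_bound Q * max_norm f"
  using rate_operator_lipschitz[of f _ "\<lambda>_. 0"]
  by (simp add: max_norm_le_iff rate_operator_const)

section \<open>Comparison of Euler compositions\<close>

text \<open>The split step evaluates the outer \<open>Q\<close> at \<open>f + b * Q f\<close>
  instead of \<open>f\<close>. The Lipschitz constant enters twice: once for this change of argument
  and once for the size of \<open>Q f\<close>.\<close>

lemma euler_step_split:
  assumes "0 \<le> a" "0 \<le> b"
  shows "\<bar>euler_step Q a (euler_step Q b f) x - euler_step Q (a + b) f x\<bar>
    \<le> 4 * (rate_bound Q)\<^sup>2 * (a * b) * max_norm f"
proof -
  have "euler_step Q a (euler_step Q b f) x - euler_step Q (a + b) f x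
      = a * (Q (\<lambda>z. f z + b * Q f z) x - Q f x)"
    by (simp add: euler_step_def algebra_simps)
  then have "\<bar>euler_step Q a (euler_step Q b f) x - euler_step Q (a + b) f x\<bar>
      = a * \<bar>Q (\<lambda>z. f z + b * Q f z) x - Q f x\<bar>"
    using assms by (simp add: abs_mult)
  also have "\<dots> \<le> a * (2 * rate_bound Q * (b * max_norm (Q f)))"
    using rate_operator_lipschitz[of "\<lambda>z. f z + b * Q f z" x f] assms
    by (intro mult_left_mono) (simp_all add: max_norm_scale)
  also have "\<dots> \<le> a * (2 * rate_bound Q * (b * (2 * rate_bound Q * max_norm f)))"
    using assms rate_bound_pos[of Q]
    by (intro mult_left_mono max_norm_rate_operator_le) auto
  finally show ?thesis by (simp add: power2_eq_square mult_ac)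
qed

text \<open>No common refinement is formed: the shorter of the two leading increments is removed from
  both lists, at the cost of one splitting.\<close>

lemma euler_composition_dist:
  assumes "\<And>d. d \<in> set as \<union> set bs \<Longrightarrow> 0 \<le> d \<and> d * rate_bound Q \<le> 1"
    and "sum_list as = sum_list bs"
  shows "\<bar>euler_composition Q as f x - euler_composition Q bs f x\<bar>
    \<le> 2 * (rate_bound Q)\<^sup>2 * max_norm f * (\<Sum>d\<leftarrow>as @ bs. d\<^sup>2)"
  using assms
\<comment> \<open>The point \<open>x\<close> must vary, since nonexpansiveness of the outer step
  needs the estimate at all states.\<close>
proof (induction "length as + length bs" arbitrary: as bs x rule: less_induct)
  case less
  \<comment> \<open>Half the squared Lipschitz constant times the norm: splitting \<open>b\<close>
    then costs at most \<open>C\<close> times \<open>2 * (a * (b - a))\<close>, the cross term in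
    the square of \<open>a + (b - a)\<close>.\<close>
  define C where "C = 2 * (rate_bound Q)\<^sup>2 * max_norm f"
  have C: "0 \<le> C" by (simp add: C_def max_norm_nonneg)
  \<comment> \<open>Only the total length is tied to the induction measure, so the claim can also be
    used with the two lists exchanged.\<close>
  have shorter_first: "\<bar>euler_composition Q (a # as') f x - euler_composition Q (b # bs') f x\<bar>
      \<le> C * (\<Sum>d\<leftarrow>(a # as') @ (b # bs'). d\<^sup>2)"
    if len: "length as + length bs = length (a # as') + length (b # bs')"
      and small: "\<And>d. d \<in> set (a # as') \<union> set (b # bs') \<Longrightarrow> 0 \<le> d \<and> d * rate_bound Q \<le> 1"
      and sums: "sum_list (a # as') = sum_list (b # bs')"
      and ab: "a \<le> b" for a b as' bs'
  proof -
    define g where "g = euler_composition Q bs' f"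
    have a: "0 \<le> a" "a * rate_bound Q \<le> 1" and b: "0 \<le> b" "b * rate_bound Q \<le> 1"
      using small by auto
    have "(b - a) * rate_bound Q \<le> b * rate_bound Q"
      using a(1) rate_bound_pos[of Q] by (intro mult_right_mono) auto
    then have ba: "0 \<le> b - a" "(b - a) * rate_bound Q \<le> 1" using ab b by auto
    \<comment> \<open>Dropping \<open>a\<close> lowers the total length by one, because
      \<open>b\<close> is merely replaced by its remainder \<open>b - a\<close>, which may be
      zero.\<close>
    have IH: "\<bar>euler_composition Q as' f z - euler_composition Q ((b - a) # bs') f z\<bar>
        \<le> C * (\<Sum>d\<leftarrow>as' @ (b - a) # bs'. d\<^sup>2)" for z
      unfolding C_def
    proof (rule less.hyps)
      show "length as' + length ((b - a) # bs') < length as + length bs" using len by simp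
      show "0 \<le> d \<and> d * rate_bound Q \<le> 1"
        if "d \<in> set as' \<union> set ((b - a) # bs')" for d
        using that small ba by auto
      show "sum_list as' = sum_list ((b - a) # bs')" using sums by simp
    qed
    have 1: "\<bar>euler_composition Q (a # as') f x - euler_step Q a (euler_step Q (b - a) g) x\<bar>
        \<le> C * (\<Sum>d\<leftarrow>as' @ (b - a) # bs'. d\<^sup>2)"
    proof -
      have "\<bar>euler_step Q a (euler_composition Q as' f) x
          - euler_step Q a (euler_composition Q ((b - a) # bs') f) x\<bar>
          \<le> max_norm (\<lambda>z. euler_composition Q as' f z - euler_composition Q ((b - a) # bs') f z)"
        by (rule lower_transition_operator_nonexpansive[OF lower_transition_operator_euler_step[OF a]])
      also have "\<dots> \<le> C * (\<Sum>d\<leftarrow>as' @ (b - a) # bs'. d\<^sup>2)"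
        using IH by (simp only: max_norm_le_iff) blast
      finally show ?thesis by (simp add: g_def)
    qed
    \<comment> \<open>The splitting error is measured at \<open>g\<close>; the steps producing
      \<open>g\<close> from \<open>f\<close> do not increase the norm.\<close>
    have "max_norm g \<le> max_norm f"
      unfolding g_def using small
      by (intro lower_transition_operator_norm_le lower_transition_operator_euler_composition) auto
    then have *: "4 * (rate_bound Q)\<^sup>2 * (a * (b - a)) * max_norm g
        \<le> 4 * (rate_bound Q)\<^sup>2 * (a * (b - a)) * max_norm f"
      using a ba by (intro mult_left_mono) auto
    have 2: "\<bar>euler_step Q a (euler_step Q (b - a) g) x - euler_composition Q (b # bs') f x\<bar>
        \<le> C * (2 * (a * (b - a)))"
      using order_trans[OF euler_step_split[OF a(1) ba(1), of g x] *]
      by (simp add: g_def C_def algebra_simps)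
    have "\<bar>euler_composition Q (a # as') f x - euler_composition Q (b # bs') f x\<bar>
        \<le> C * ((\<Sum>d\<leftarrow>as' @ (b - a) # bs'. d\<^sup>2) + 2 * (a * (b - a)))"
      using 1 2 by (simp only: distrib_left)
    \<comment> \<open>Here \<open>(b - a)^2 + 2 * a * (b - a) = b^2 - a^2\<close>, so the squares of
      the original lists dominate.\<close>
    also have "\<dots> \<le> C * (\<Sum>d\<leftarrow>(a # as') @ (b # bs'). d\<^sup>2)"
      using C by (intro mult_left_mono) (simp_all add: power2_eq_square algebra_simps)
    finally show ?thesis .
  qed
  \<comment> \<open>Once one list is exhausted, the other has total zero. It may still contain zero
    steps, left over from equal leading increments.\<close>
  have zero: "euler_composition Q ds = id"
    if "sum_list ds = 0" "\<And>d. d \<in> set ds \<Longrightarrow> 0 \<le> d" for ds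
    using that by (intro euler_composition_zero) (simp add: sum_list_nonneg_eq_0_iff)
  show ?case
  proof (cases "as = [] \<or> bs = []")
    case True
    then have "euler_composition Q as = id" "euler_composition Q bs = id"
      using less.prems by (auto intro!: zero)
    moreover have "0 \<le> C * (\<Sum>d\<leftarrow>as @ bs. d\<^sup>2)"
      using C by (intro mult_nonneg_nonneg sum_list_nonneg) auto
    ultimately show ?thesis by (simp add: C_def)
  next
    case False
    then obtain a as' b bs' where [simp]: "as = a # as'" "bs = b # bs'"
      by (meson neq_Nil_conv)
    show ?thesis
    proof (cases "a \<le> b")
      case True
      show ?thesis
        using shorter_first[of a as' b bs'] True less.prems by (simp add: C_def)
    next
      case False
      have "\<bar>euler_composition Q bs f x - euler_composition Q as f x\<bar> \<le> C * (\<Sum>d\<leftarrow>bs @ as. d\<^sup>2)"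
        unfolding \<open>as = _\<close> \<open>bs = _\<close>
        by (rule shorter_first) (use False less.prems in auto)
      then show ?thesis by (simp add: C_def abs_minus_commute add_ac)
    qed
  qed
qed

end

section \<open>Increments, mesh and fine partitions\<close>

definition increments :: "real list \<Rightarrow> real list" where
  "increments u = map (increment u) [1..<length u]"

lemma euler_product_eq_composition: "euler_product Q u = euler_composition Q (increments u)"
  by (simp add: euler_product_def euler_composition_def increments_def foldr_map comp_def)

lemma sum_list_increments:
  assumes "u \<in> partitions t s"
  shows "sum_list (increments u) = s - t"
proof -
  have u: "u \<noteq> []" "hd u = t" "last u = s" using assms by (auto simp: partitions_def)
  have "sum_list (increments u) = (\<Sum>i\<in>{1..<length u}. increment u i)"
    by (simp add: increments_def sum_list_distinct_conv_sum_set)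
  also have "\<dots> = (\<Sum>i\<in>{Suc 0..<Suc (length u - 1)}. u ! i - u ! (i - 1))"
    using u(1) by (intro sum.cong) (auto simp: increment_def)
  also have "\<dots> = (\<Sum>i<length u - 1. u ! Suc i - u ! i)"
    by (subst sum.shift_bounds_Suc_ivl) (simp add: lessThan_atLeast0)
  also have "\<dots> = u ! (length u - 1) - u ! 0" by (rule sum_lessThan_telescope)
  finally show ?thesis using u by (simp add: hd_conv_nth last_conv_nth)
qed

lemma increments_bounds:
  assumes "u \<in> partitions t s" "d \<in> set (increments u)"
  shows "0 \<le> d" "d \<le> mesh u"
proof -
  obtain i where i: "1 \<le> i" "i < length u" "d = increment u i"
    using assms(2) by (auto simp: increments_def)
  have "sorted_wrt (<) u" using assms(1) by (simp add: partitions_def)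
  then have "u ! (i - 1) < u ! i" by (rule sorted_wrt_nth_less) (use i in auto)
  then show "0 \<le> d" using i by (simp add: increment_def)
  show "d \<le> mesh u" using i by (auto simp: mesh_def)
qed

text \<open>One factor of each square is bounded by the mesh and the other factors telescope, so the
  comparison error vanishes with the mesh.\<close>

lemma sum_squares_increments_le:
  assumes "u \<in> partitions t s"
  shows "(\<Sum>d\<leftarrow>increments u. d\<^sup>2) \<le> mesh u * (s - t)"
proof -
  have "(\<Sum>d\<leftarrow>increments u. d\<^sup>2) \<le> (\<Sum>d\<leftarrow>increments u. mesh u * d)"
    using increments_bounds[OF assms]
    by (intro sum_list_mono) (auto simp: power2_eq_square intro!: mult_right_mono)
  then show ?thesis by (simp add: sum_list_const_mult sum_list_increments[OF assms])
qed

lemma mesh_nonneg: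
  assumes "u \<in> partitions t s"
  shows "0 \<le> mesh u"
proof (cases "increments u")
  \<comment> \<open>Without increments there is at most one point, and \<open>mesh\<close> takes its
    default value 0.\<close>
  case Nil
  then show ?thesis by (auto simp: mesh_def increments_def)
next
  case (Cons d ds)
  then show ?thesis using increments_bounds[OF assms, of d] by simp
qed

text \<open>Such partitions keep the limit condition from being vacuous; they serve both the
  construction of the limit and its uniqueness.\<close>

lemma ex_partition_mesh_le:
  assumes "t \<le> s" "0 < \<delta>"
  shows "\<exists>u\<in>partitions t s. mesh u \<le> \<delta>"
proof (cases "t = s")
  case True
  then show ?thesis using assms by (intro bexI[of _ "[t]"]) (auto simp: partitions_def mesh_def)
next
  case False
  \<comment> \<open>Enough equal steps to bring their length to at most \<open>\<delta>\<close>; the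
    \<open>Suc\<close> gives \<open>n > 0\<close> at once.\<close>
  define n where "n = Suc (nat \<lceil>(s - t) / \<delta>\<rceil>)"
  have n_pos: "0 < n" by (simp add: n_def)
  define h where "h = (s - t) / n"
  define u where "u = map (\<lambda>i. t + real i * h) [0..<Suc n]"
  have h: "0 < h" "real n * h = s - t"
    using assms False by (simp_all add: h_def n_pos)
  have "(s - t) / \<delta> \<le> n" unfolding n_def by linarith
  then have "h \<le> \<delta>" using assms n_pos by (simp add: h_def field_simps)
  have "hd u = t" by (simp add: u_def hd_map del: upt_Suc)
  moreover have "sorted_wrt (<) u"
    using h by (auto simp: u_def sorted_wrt_iff_nth_less simp del: upt_Suc)
  ultimately have "u \<in> partitions t s"
    using h by (simp add: partitions_def u_def)
  moreover have "increment u i = h" if "1 \<le> i" "i < length u" for i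
    using that less_imp_diff_less[of i "Suc n" 1]
    by (simp add: increment_def u_def of_nat_diff algebra_simps nth_upt del: upt_Suc)
  then have "mesh u \<le> \<delta>"
    using \<open>h \<le> \<delta>\<close> by (auto simp: mesh_def u_def n_def)
  ultimately show ?thesis by blast
qed

lemma increments_small:
  assumes u: "u \<in> partitions t s" "mesh u * rate_bound Q \<le> 1" and d: "d \<in> set (increments u)"
  shows "0 \<le> d \<and> d * rate_bound Q \<le> 1"
proof -
  have "d * rate_bound Q \<le> mesh u * rate_bound Q"
    using increments_bounds[OF u(1) d] rate_bound_pos[of Q] by (intro mult_right_mono) auto
  then show ?thesis using increments_bounds[OF u(1) d] u(2) by simp
qed

section \<open>Limit of the Euler products\<close>

text \<open>This is the Cauchy estimate: both lists of increments have total \<open>s - t\<close>,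
  so their compositions are comparable.\<close>

lemma euler_product_dist:
  assumes Q: "lower_transition_rate_operator Q"
    and u: "u \<in> partitions t s" "mesh u * rate_bound Q \<le> 1"
    and v: "v \<in> partitions t s" "mesh v * rate_bound Q \<le> 1"
  shows "\<bar>euler_product Q u f x - euler_product Q v f x\<bar>
    \<le> 2 * (rate_bound Q)\<^sup>2 * (s - t) * max_norm f * (mesh u + mesh v)"
proof -
  have "\<bar>euler_product Q u f x - euler_product Q v f x\<bar>
      \<le> 2 * (rate_bound Q)\<^sup>2 * max_norm f * (\<Sum>d\<leftarrow>increments u @ increments v. d\<^sup>2)"
    unfolding euler_product_eq_composition
    using u v
    by (intro euler_composition_dist[OF Q])
      (auto simp: sum_list_increments dest: increments_small)
  also have "\<dots> \<le> 2 * (rate_bound Q)\<^sup>2 * max_norm f * (mesh u * (s - t) + mesh v * (s - t))"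
    using sum_squares_increments_le[OF u(1)] sum_squares_increments_le[OF v(1)]
    by (intro mult_left_mono) (auto simp: max_norm_nonneg)
  finally show ?thesis by (simp add: algebra_simps)
qed

lemma lower_transition_operator_euler_product:
  assumes Q: "lower_transition_rate_operator Q"
    and u: "u \<in> partitions t s" "mesh u * rate_bound Q \<le> 1"
  shows "lower_transition_operator (euler_product Q u)"
  unfolding euler_product_eq_composition
  by (intro lower_transition_operator_euler_composition[OF Q] increments_small[OF u])

text \<open>The explicit factor \<open>max_norm f\<close> makes the error uniform on the unit
  sphere, as convergence in operator norm requires.\<close>

lemma ex_lower_transition_operator_limit:
  assumes "t \<le> s" and Q: "lower_transition_rate_operator Q"
  obtains T where "lower_transition_operator T"
    "\<And>u f x. u \<in> partitions t s \<Longrightarrow> mesh u * rate_bound Q \<le> 1 \<Longrightarrow>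
      \<bar>T f x - euler_product Q u f x\<bar> \<le> 2 * (rate_bound Q)\<^sup>2 * (s - t) * max_norm f * mesh u"
proof -
  define K where "K = rate_bound Q"
  have K: "0 < K" by (simp add: K_def rate_bound_pos)
  \<comment> \<open>The factor \<open>1 / K\<close> keeps every step small enough to be a lower
    transition operator; the factor \<open>1 / Suc n\<close> sends the mesh to 0.\<close>
  have "\<exists>u\<in>partitions t s. mesh u \<le> inverse (K * Suc n)" for n
    using K by (intro ex_partition_mesh_le assms) simp
  then obtain v where v: "\<And>n. v n \<in> partitions t s" "\<And>n. mesh (v n) \<le> inverse (K * Suc n)"
    by metis
  have v_small: "mesh (v n) * rate_bound Q \<le> 1" for n
  proof -
    have "mesh (v n) * K \<le> inverse (K * Suc n) * K" using v K by (intro mult_right_mono) auto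
    also have "\<dots> = inverse (Suc n)" using K by (simp del: of_nat_Suc)
    also have "\<dots> \<le> 1" by (simp add: field_simps)
    finally show ?thesis by (simp add: K_def)
  qed
  have mesh_lim: "(\<lambda>n. mesh (v n)) \<longlonglongrightarrow> 0"
  proof (rule tendsto_sandwich)
    show "\<forall>\<^sub>F n in sequentially. 0 \<le> mesh (v n)" by (simp add: mesh_nonneg[OF v(1)])
    show "\<forall>\<^sub>F n in sequentially. mesh (v n) \<le> inverse K * inverse (Suc n)"
      using v(2) by (simp add: inverse_mult_distrib)
    show "(\<lambda>n. inverse K * inverse (real (Suc n))) \<longlonglongrightarrow> 0"
      using tendsto_mult_right_zero[OF LIMSEQ_inverse_real_of_nat] .
  qed simp
  define S where "S n = euler_product Q (v n)" for n
  define C where "C f = 2 * (rate_bound Q)\<^sup>2 * (s - t) * max_norm f" for f :: "'a \<Rightarrow> real"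
  have C: "0 \<le> C f" for f using assms by (simp add: C_def max_norm_nonneg)
  \<comment> \<open>Taking \<open>u\<close> from the sequence \<open>v\<close> gives the Cauchy
    property; keeping \<open>u\<close> fixed gives the final error bound.\<close>
  have near: "\<bar>S n f x - euler_product Q u f x\<bar> \<le> C f * (mesh (v n) + mesh u)"
    if "u \<in> partitions t s" "mesh u * rate_bound Q \<le> 1" for n u f x
    unfolding S_def C_def by (rule euler_product_dist[OF Q v(1) v_small that])
  have "convergent (\<lambda>n. S n f x)" for f x
  proof (rule Cauchy_convergent, rule metric_CauchyI)
    fix e :: real assume e: "0 < e"
    have "(\<lambda>n. C f * mesh (v n)) \<longlonglongrightarrow> 0"
      using tendsto_mult_right_zero[OF mesh_lim] .
    then have "\<forall>\<^sub>F n in sequentially. C f * mesh (v n) < e / 2"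
      using e by (intro order_tendstoD(2)) auto
    then obtain N where N: "\<And>n. n \<ge> N \<Longrightarrow> C f * mesh (v n) < e / 2"
      by (auto simp: eventually_sequentially)
    have "dist (S m f x) (S n f x) < e" if "m \<ge> N" "n \<ge> N" for m n
    proof -
      have "dist (S m f x) (S n f x) \<le> C f * (mesh (v m) + mesh (v n))"
        using near[OF v(1) v_small, of m f x n] by (simp add: dist_real_def S_def)
      also have "\<dots> < e" using N[OF that(1)] N[OF that(2)] by (simp add: distrib_left)
      finally show ?thesis .
    qed
    then show "\<exists>M. \<forall>m\<ge>M. \<forall>n\<ge>M. dist (S m f x) (S n f x) < e" by blast
  qed
  then have "\<exists>T. \<forall>f x. (\<lambda>n. S n f x) \<longlonglongrightarrow> T f x"
    unfolding convergent_def by metis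
  then obtain T where T: "\<And>f x. (\<lambda>n. S n f x) \<longlonglongrightarrow> T f x" by blast
  show ?thesis
  proof
    show "lower_transition_operator T"
      by (rule lower_transition_operator_limit[OF _ T])
        (simp add: S_def lower_transition_operator_euler_product[OF Q v(1) v_small])
    fix u f x
    assume u: "u \<in> partitions t s" "mesh u * rate_bound Q \<le> 1"
    \<comment> \<open>With \<open>u\<close> fixed, letting \<open>n\<close> grow removes
      \<open>mesh (v n)\<close> from the bound.\<close>
    have "(\<lambda>n. C f * (mesh (v n) + mesh u)) \<longlonglongrightarrow> C f * (0 + mesh u)"
      by (intro tendsto_intros mesh_lim)
    moreover have "(\<lambda>n. \<bar>S n f x - euler_product Q u f x\<bar>) \<longlonglongrightarrow> \<bar>T f x - euler_product Q u f x\<bar>"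
      by (intro tendsto_intros T)
    ultimately show "\<bar>T f x - euler_product Q u f x\<bar>
        \<le> 2 * (rate_bound Q)\<^sup>2 * (s - t) * max_norm f * mesh u"
      using near[OF u] by (auto simp: C_def intro!: LIMSEQ_le)
  qed
qed

section \<open>Existence and uniqueness in operator norm\<close>

text \<open>The operator norm only sees the unit sphere; homogeneity carries agreement there to
  every nonzero function, and both operators fix 0.\<close>

lemma lower_transition_operator_eqI:
  assumes S: "lower_transition_operator S" and T: "lower_transition_operator T"
    and eq: "\<And>f x. max_norm f = 1 \<Longrightarrow> S f x = T f x"
  shows "S = T"
proof (intro ext)
  fix f x
  show "S f x = T f x"
  proof (cases "max_norm f = 0")
    case True
    then have "f = (\<lambda>_. 0)" using max_norm_le_iff[of f 0] by auto
    then show ?thesis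
      by (simp add: lower_transition_operator_zero[OF S] lower_transition_operator_zero[OF T])
  next
    case False
    define g where "g = (\<lambda>z. inverse (max_norm f) * f z)"
    have "max_norm g = 1" using False by (simp add: g_def max_norm_scale max_norm_nonneg)
    moreover have "f = (\<lambda>z. max_norm f * g z)"
      using False by (simp add: g_def mult.assoc[symmetric])
    ultimately show ?thesis
      using lower_transition_operatorD(3)[OF S max_norm_nonneg, of f g x]
        lower_transition_operatorD(3)[OF T max_norm_nonneg, of f g x] eq by metis
  qed
qed

theorem theorem7p12:
  fixes t s :: real
    and Q :: "('x::finite \<Rightarrow> real) \<Rightarrow> ('x \<Rightarrow> real)"
  assumes "0 \<le> t" and "0 \<le> s" and "t \<le> s"
    and "lower_transition_rate_operator Q"
  shows "\<exists>!T :: ('x \<Rightarrow> real) \<Rightarrow> ('x \<Rightarrow> real).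
           lower_transition_operator T \<and>
           (\<forall>\<epsilon>>0. \<exists>\<delta>>0. \<forall>u\<in>partitions t s. mesh u \<le> \<delta> \<longrightarrow>
              op_norm (op_diff T (euler_product Q u)) \<le> ereal \<epsilon>)"
proof (rule ex_ex1I)
  define K where "K = rate_bound Q"
  have K: "0 < K" by (simp add: K_def rate_bound_pos)
  define C where "C = 2 * K\<^sup>2 * (s - t)"
  have C: "0 \<le> C" using assms by (simp add: C_def)
  obtain T where T: "lower_transition_operator T"
    "\<And>u f x. u \<in> partitions t s \<Longrightarrow> mesh u * K \<le> 1 \<Longrightarrow>
      \<bar>T f x - euler_product Q u f x\<bar> \<le> C * max_norm f * mesh u"
    using ex_lower_transition_operator_limit[OF assms(3,4)] unfolding K_def C_def by metis
  have "\<exists>\<delta>>0. \<forall>u\<in>partitions t s. mesh u \<le> \<delta> \<longrightarrow>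
      op_norm (op_diff T (euler_product Q u)) \<le> ereal \<epsilon>" if "0 < \<epsilon>" for \<epsilon>
  proof (intro exI conjI ballI impI)
    \<comment> \<open>The first bound makes the error estimate applicable, the second makes it at
      most \<open>\<epsilon>\<close>. Adding 1 avoids division by zero, as \<open>C = 0\<close> when
      \<open>t = s\<close>.\<close>
    define \<delta> where "\<delta> = min (1 / K) (\<epsilon> / (C + 1))"
    show "0 < \<delta>" using K C that by (simp add: \<delta>_def)
    fix u assume u: "u \<in> partitions t s" "mesh u \<le> \<delta>"
    have small: "mesh u * K \<le> 1" using u K by (simp add: \<delta>_def field_simps)
    have "C * mesh u \<le> (C + 1) * mesh u" using mesh_nonneg[OF u(1)] by (simp add: distrib_right)
    also have "\<dots> \<le> \<epsilon>" using u C by (simp add: \<delta>_def field_simps)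
    finally have "C * mesh u \<le> \<epsilon>" .
    then show "op_norm (op_diff T (euler_product Q u)) \<le> ereal \<epsilon>"
      using T(2)[OF u(1) small]
      by (fastforce simp: op_norm_diff_le_iff intro: order_trans)
  qed
  with T(1) show "\<exists>T. lower_transition_operator T \<and>
      (\<forall>\<epsilon>>0. \<exists>\<delta>>0. \<forall>u\<in>partitions t s. mesh u \<le> \<delta> \<longrightarrow>
        op_norm (op_diff T (euler_product Q u)) \<le> ereal \<epsilon>)" by blast
next
  fix S T :: "('x \<Rightarrow> real) \<Rightarrow> ('x \<Rightarrow> real)"
  assume S: "lower_transition_operator S \<and> (\<forall>\<epsilon>>0. \<exists>\<delta>>0. \<forall>u\<in>partitions t s. mesh u \<le> \<delta> \<longrightarrow>
      op_norm (op_diff S (euler_product Q u)) \<le> ereal \<epsilon>)"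
    and T: "lower_transition_operator T \<and> (\<forall>\<epsilon>>0. \<exists>\<delta>>0. \<forall>u\<in>partitions t s. mesh u \<le> \<delta> \<longrightarrow>
      op_norm (op_diff T (euler_product Q u)) \<le> ereal \<epsilon>)"
  show "S = T"
  proof (rule lower_transition_operator_eqI)
    fix f :: "'x \<Rightarrow> real" and x assume f: "max_norm f = 1"
    have "\<bar>S f x - T f x\<bar> \<le> \<epsilon>" if \<epsilon>: "0 < \<epsilon>" for \<epsilon>
    proof -
      obtain \<delta> where "0 < \<delta>" "\<forall>u\<in>partitions t s. mesh u \<le> \<delta> \<longrightarrow>
          op_norm (op_diff S (euler_product Q u)) \<le> ereal (\<epsilon> / 2)"
        using S half_gt_zero[OF \<epsilon>] by blast
      moreover obtain \<delta>' where "0 < \<delta>'" "\<forall>u\<in>partitions t s. mesh u \<le> \<delta>' \<longrightarrow>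
          op_norm (op_diff T (euler_product Q u)) \<le> ereal (\<epsilon> / 2)"
        using T half_gt_zero[OF \<epsilon>] by blast
      ultimately have d: "0 < \<delta>" "0 < \<delta>'"
        "\<And>u. u \<in> partitions t s \<Longrightarrow> mesh u \<le> \<delta> \<Longrightarrow>
          op_norm (op_diff S (euler_product Q u)) \<le> ereal (\<epsilon> / 2)"
        "\<And>u. u \<in> partitions t s \<Longrightarrow> mesh u \<le> \<delta>' \<Longrightarrow>
          op_norm (op_diff T (euler_product Q u)) \<le> ereal (\<epsilon> / 2)"
        by blast+
      \<comment> \<open>A single partition fine enough for both limits puts \<open>S f x\<close> and
        \<open>T f x\<close> within \<open>\<epsilon> / 2\<close> of the same value.\<close>
      obtain u where u: "u \<in> partitions t s" "mesh u \<le> min \<delta> \<delta>'"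
        using ex_partition_mesh_le[OF assms(3), of "min \<delta> \<delta>'"] d by auto
      then have "\<bar>S f x - euler_product Q u f x\<bar> \<le> \<epsilon> / 2"
        "\<bar>T f x - euler_product Q u f x\<bar> \<le> \<epsilon> / 2"
        using d(3,4)[of u] f unfolding op_norm_diff_le_iff by simp_all
      then show ?thesis by linarith
    qed
    then show "S f x = T f x"
      using field_le_epsilon[of "\<bar>S f x - T f x\<bar>" 0] by simp
  qed (use S T in auto)
qed

end
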